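(* Let a vehicle have mass $m>0$, maximum thrust $f_{max}>mg$, drag constant $K_d>0$, sensor range $r_s$, sensor sample period $\Delta T_s$, clearance radius $r_c$ and (user- or vehicle-defined) minimum turn radius $r_{min}>0$; let $v_{o,max}$ be the expected maximum obstacle speed, and let $f_{planar}=\sqrt{f_{max}^2-(mg)^2}$. Let the vehicle's maximum cruise velocity be $$v_c=\min\left(v_{c,v},\,v_{c,s}\right),$$ where $v_{c,v}$ is the minimum real, positive solution of $$\left(\frac{m}{r_{min}}+K_d\right)v_{c,v}^2+2K_dv_{air}v_{c,v}+K_dv_{air}^2-f_{planar}=0,$$ and the speed $v_{c,s}>0$ is solved simultaneously with the sigmoid curve timespan $\tau_f$ from the two relations $$\int_0^{\tau_f}v_{c,s}\sin\phi(t)\,dt\le r_s-r_c-v_{o,max}\tau_f-v_{c,s}\Delta T_s,$$ $$\tau_f=\begin{cases}\dfrac{c_3m\,\Delta\phi_2\,v_{c,s}}{f_{planar}-K_d(v_{c,s}+v_{air})^2}+\dfrac12\tau_{f,1}, & 2\Delta T_s\ge\tau_{f,1},\\[3mm]\sqrt{\dfrac{c_3m\,\tau_{f,1}\,\Delta\phi_2\,v_{c,s}}{2\left(f_{planar}-K_d(v_{c,s}+v_{air})^2\right)}}+\dfrac12\tau_{f,1}, & 2\Delta T_s<\tau_{f,1},\end{cases}$$ with $$\Delta\phi_1=\cos^{-1}\left(\frac{r_s-\Delta T_s(v_{o,max}+v_{c,s})}{r_s}\right)+\sin^{-1}\left(\frac{r_c}{r_s}\right),$$ $$\Delta\phi_2=\frac{\pi}{2}+\sin^{-1}\left(\frac{v_{o,max}}{v_{c,s}}\right)-\Delta\phi_1,\qquad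 \tau_{f,1}=\frac{c_3m\,\Delta\phi_1\,v_{c,s}}{f_{planar}-K_d(v_{c,s}+v_{air})^2}.$$ Then, for this $v_c$, the vehicle (travelling at the constant cruise speed $v_c$) does not violate the thrust limit $f_{max}$ when making a planar turn of radius $r_t\ge r_{min}$, for a bounded wind disturbance of magnitude $v_{air}$ applied in any direction, where $v_{air}<\sqrt{f_{planar}/K_d}$.
   Context: Vehicle and forces. Gravity is $g$ and the trajectory is planar (horizontal). The wind has a planar velocity $\mathbf v_{air}$ of arbitrary direction and magnitude at most $v_{air}\ge0$. With relative velocity $\mathbf v_w=\dot{\mathbf p}-\mathbf v_{air}$ and $\mathbf x_W$ the unit vector along $\mathbf v_w$, the drag force on the vehicle is $-K_d\|\mathbf v_w\|^2\mathbf x_W$, where $K_d=\tfrac12\rho C_DA_{x_W}$ is a known constant. The thrust required to follow the trajectory has vertical component $mg$ and planar component $m\ddot{\mathbf p}+K_d\|\mathbf v_w\|^2\mathbf x_W$. "Does not violate $f_{max}$" means that the total required thrust has magnitude at most $f_{max}$, equivalently its planar component has magnitude at most $f_{planar}$. In a turn of radius $r_t$ at constant speed $v_c$, $\ddot{\mathbf p}$ is the centripetal acceleration, of magnitude $v_c^2/r_t$. Notation. $c_3=\tanh^{-1}(\varepsilon_1)\approx3.8$ with $\varepsilon_1=1-10^{-3}$. $\phi(t)$ is the heading of the vehicle during an obstacle-avoidance maneuver at speed $v_{c,s}$ which turns the vehicle first by $\Delta\phi_1$ and then by $\Delta\phi_2$; each heading change $\Delta\phi_k$ is a sigmoid contribution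 $\tfrac12\Delta\phi_k\tanh(2c_3\tau/\tau_{f,k}-c_3)+\tfrac12\Delta\phi_k$, with $\tau$ the time since the start of that sigmoid and $\tau_{f,k}$ its timespan, the contributions being summed; $\tau_f$ is the total timespan of the maneuver. *)

theory Defs
  imports "HOL-Analysis.Analysis"
begin

definition c3 :: real where
  "c3 = artanh (1 - 1 / 10 ^ 3)"

definition planar_force_limit :: "real \<Rightarrow> real \<Rightarrow> real \<Rightarrow> real" where
  "planar_force_limit m g f_max = sqrt (f_max\<^sup>2 - (m * g)\<^sup>2)"

definition vehicle_limited_speed :: "real \<Rightarrow> real \<Rightarrow> real \<Rightarrow> real \<Rightarrow> real \<Rightarrow> real" where
  "vehicle_limited_speed m K_d r_min v_air f_planar =
     (LEAST v. v > 0 \<and>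
        (m / r_min + K_d) * v\<^sup>2 + 2 * K_d * v_air * v + K_d * v_air\<^sup>2 - f_planar = 0)"

text \<open>
  The heading rate of a sigmoid of height \<open>\<Delta>\<phi>\<close> and timespan \<open>\<tau>\<close> peaks at \<open>c3 * \<Delta>\<phi> / \<tau>\<close>;
  the value below is the \<open>\<tau>\<close> for which the centripetal force at that peak uses up
  what the worst-case drag leaves of the planar force.
\<close>

definition sigmoid_timespan :: "real \<Rightarrow> real \<Rightarrow> real \<Rightarrow> real \<Rightarrow> real \<Rightarrow> real \<Rightarrow> real" where
  "sigmoid_timespan m K_d v_air f_planar v \<Delta>\<phi> =
     c3 * m * \<Delta>\<phi> * v / (f_planar - K_d * (v + v_air)\<^sup>2)"

definition heading_change1 :: "real \<Rightarrow> real \<Rightarrow> real \<Rightarrow> real \<Rightarrow> real \<Rightarrow> real" where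
  "heading_change1 r_s r_c \<Delta>T_s v_omax v =
     arccos ((r_s - \<Delta>T_s * (v_omax + v)) / r_s) + arcsin (r_c / r_s)"

definition heading_change2 :: "real \<Rightarrow> real \<Rightarrow> real \<Rightarrow> real \<Rightarrow> real \<Rightarrow> real" where
  "heading_change2 r_s r_c \<Delta>T_s v_omax v =
     pi / 2 + arcsin (v_omax / v) - heading_change1 r_s r_c \<Delta>T_s v_omax v"

definition sigmoid :: "real \<Rightarrow> real \<Rightarrow> real \<Rightarrow> real" where
  "sigmoid \<Delta>\<phi> \<tau>f \<tau> = \<Delta>\<phi> / 2 * tanh (2 * c3 * \<tau> / \<tau>f - c3) + \<Delta>\<phi> / 2"

text \<open>
  The second sigmoid starts at \<open>\<tau>f1 / 2\<close>, when the heading rate of the first one peaks, and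
  ends with the maneuver at \<open>\<tau>f\<close>; its timespan is thus \<open>\<tau>f - \<tau>f1 / 2\<close>.
\<close>

definition maneuver_heading :: "real \<Rightarrow> real \<Rightarrow> real \<Rightarrow> real \<Rightarrow> real \<Rightarrow> real" where
  "maneuver_heading \<Delta>\<phi>1 \<Delta>\<phi>2 \<tau>f1 \<tau>f t =
     sigmoid \<Delta>\<phi>1 \<tau>f1 t + sigmoid \<Delta>\<phi>2 (\<tau>f - \<tau>f1 / 2) (t - \<tau>f1 / 2)"

text \<open>
  Because of the inequality these relations need not single out one pair of \<open>v\<close> and \<open>\<tau>f\<close>;
  every solution with \<open>v > 0\<close> is admitted.
\<close>

definition sensor_limited_speed ::
  "real \<Rightarrow> real \<Rightarrow> real \<Rightarrow> real \<Rightarrow> real \<Rightarrow> real \<Rightarrow> real \<Rightarrow> real \<Rightarrow> real \<Rightarrow> real \<Rightarrow> bool" where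
  "sensor_limited_speed m K_d v_air f_planar r_s r_c \<Delta>T_s v_omax v \<tau>f \<longleftrightarrow>
     (let \<Delta>\<phi>1 = heading_change1 r_s r_c \<Delta>T_s v_omax v;
          \<Delta>\<phi>2 = heading_change2 r_s r_c \<Delta>T_s v_omax v;
          \<tau>f1 = sigmoid_timespan m K_d v_air f_planar v \<Delta>\<phi>1
      in v > 0 \<and>
         integral {0..\<tau>f} (\<lambda>t. v * sin (maneuver_heading \<Delta>\<phi>1 \<Delta>\<phi>2 \<tau>f1 \<tau>f t))
           \<le> r_s - r_c - v_omax * \<tau>f - v * \<Delta>T_s \<and>
         \<tau>f = (if 2 * \<Delta>T_s \<ge> \<tau>f1
               then c3 * m * \<Delta>\<phi>2 * v / (f_planar - K_d * (v + v_air)\<^sup>2) + \<tau>f1 / 2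
               else sqrt (c3 * m * \<tau>f1 * \<Delta>\<phi>2 * v / (2 * (f_planar - K_d * (v + v_air)\<^sup>2)))
                    + \<tau>f1 / 2))"

text \<open>
  \<open>T\<close> is meant to be a nondegenerate interval of time. Then \<open>p''\<close> is the centripetal acceleration,
  of norm \<open>s\<^sup>2 / r\<close>; this is a consequence and not part of the definition.
\<close>

definition planar_turn ::
  "real \<Rightarrow> real \<Rightarrow> real set \<Rightarrow> (real \<Rightarrow> real^2) \<Rightarrow> (real \<Rightarrow> real^2) \<Rightarrow> (real \<Rightarrow> real^2) \<Rightarrow> bool" where
  "planar_turn r s T p p' p'' \<longleftrightarrow>
     (\<exists>c. \<forall>t\<in>T. p t \<in> sphere c r) \<and>
     (\<forall>t\<in>T. (p has_vector_derivative p' t) (at t within T) \<and>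
            (p' has_vector_derivative p'' t) (at t within T) \<and>
            norm (p' t) = s)"

text \<open>
  \<open>sgn v_w\<close> is the unit vector along \<open>v_w\<close>, and \<open>0\<close> for \<open>v_w = 0\<close>, where the drag vanishes anyway.
\<close>

definition drag_force :: "real \<Rightarrow> real^2 \<Rightarrow> real^2" where
  "drag_force K_d v_w = - ((K_d * (norm v_w)\<^sup>2) *\<^sub>R sgn v_w)"

text \<open>
  Required thrust as a pair of its planar and its vertical component; the norm of the pair is
  the Euclidean magnitude of the total thrust.
\<close>

definition required_thrust ::
  "real \<Rightarrow> real \<Rightarrow> real \<Rightarrow> real^2 \<Rightarrow> real^2 \<Rightarrow> real^2 \<Rightarrow> (real^2) \<times> real" where
  "required_thrust m g K_d wind vel acc = (m *\<^sub>R acc - drag_force K_d (vel - wind), m * g)"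

end

theory Submission
  imports Defs
begin

text \<open>
  The centripetal force \<open>m v\<^sup>2 / r\<close> and the worst-case (head wind) drag \<open>K_d (v + v_air)\<^sup>2\<close> add up
  to a quadratic polynomial in \<open>v\<close> that increases for \<open>v \<ge> 0\<close>, and \<open>v_cv\<close> is its only positive
  crossing of \<open>f_planar\<close>. So every speed in \<open>[0, v_cv]\<close> respects the limit, and the sensor
  constraint matters only through \<open>v_cs > 0\<close>.
\<close>

lemma strict_mono_quadratic:
  fixes a b c x y :: real
  assumes "a > 0" "b \<ge> 0" "0 \<le> x" "x < y"
  shows "a * x\<^sup>2 + b * x + c < a * y\<^sup>2 + b * y + c"
proof -
  have "x\<^sup>2 < y\<^sup>2"
    using assms by (intro power_strict_mono) auto
  then have "a * x\<^sup>2 < a * y\<^sup>2"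
    using \<open>a > 0\<close> by simp
  moreover have "b * x \<le> b * y"
    using assms by (intro mult_left_mono) auto
  ultimately show ?thesis by linarith
qed

text \<open>\<open>LEAST\<close> on the reals is informative only once a minimum is exhibited: the
  intermediate value theorem supplies a positive root, and strict monotonicity excludes a smaller
  one.\<close>

lemma quadratic_Least_pos_root:
  fixes a b c :: real
  assumes "a > 0" "b \<ge> 0" "c < 0"
  defines "v \<equiv> LEAST v. v > 0 \<and> a * v\<^sup>2 + b * v + c = 0"
  shows "v > 0" "a * v\<^sup>2 + b * v + c = 0"
proof -
  let ?q = "\<lambda>x. a * x\<^sup>2 + b * x + c"
  \<comment> \<open>Chosen so that \<open>a * M = a - c\<close>; as \<open>M > 1\<close>, the
    polynomial at \<open>M\<close> is at least \<open>a * M + b * M + c \<ge> a > 0\<close>.\<close>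
  define M where "M = 1 - c / a"
  have "M > 1"
    using assms by (simp add: M_def divide_neg_pos)
  then have "a * M\<^sup>2 \<ge> a * M"
    using \<open>a > 0\<close> by (simp add: power2_eq_square)
  moreover have "a * M = a - c"
    using \<open>a > 0\<close> by (simp add: M_def field_simps)
  moreover have "b * M \<ge> 0"
    using \<open>M > 1\<close> \<open>b \<ge> 0\<close> by simp
  ultimately have "?q M \<ge> 0"
    using \<open>a > 0\<close> by linarith
  moreover have "?q 0 \<le> 0"
    using \<open>c < 0\<close> by simp
  moreover have "continuous_on {0..M} ?q"
    by (intro continuous_intros)
  ultimately obtain x where x: "0 \<le> x" "x \<le> M" "?q x = 0"
    using IVT'[of ?q 0 0 M] \<open>M > 1\<close> by auto
  have "x \<noteq> 0"
    using x(3) \<open>c < 0\<close> by auto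
  then have "x > 0"
    using x(1) by simp
  moreover have "x \<le> y" if "y > 0 \<and> ?q y = 0" for y
  proof (rule ccontr)
    assume "\<not> x \<le> y"
    then have "?q y < ?q x"
      using that assms by (intro strict_mono_quadratic) auto
    then show False
      using that x(3) by simp
  qed
  ultimately have "v = x"
    unfolding v_def using x(3) by (intro Least_equality) auto
  then show "v > 0" "?q v = 0"
    using \<open>x > 0\<close> x(3) by auto
qed

lemma vehicle_limited_speed:
  assumes "m > 0" "K_d > 0" "r_min > 0" "0 \<le> v_air" "v_air < sqrt (f_planar / K_d)"
  shows vehicle_limited_speed_pos: "vehicle_limited_speed m K_d r_min v_air f_planar > 0"
    and vehicle_limited_speed_planar_force:
      "\<And>v. 0 \<le> v \<Longrightarrow> v \<le> vehicle_limited_speed m K_d r_min v_air f_planar \<Longrightarrow>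
        m * (v\<^sup>2 / r_min) + K_d * (v + v_air)\<^sup>2 \<le> f_planar"
proof -
  let ?a = "m / r_min + K_d" and ?b = "2 * K_d * v_air" and ?c = "K_d * v_air\<^sup>2 - f_planar"
  define w where "w = vehicle_limited_speed m K_d r_min v_air f_planar"
  have w_eq: "w = (LEAST v. v > 0 \<and> ?a * v\<^sup>2 + ?b * v + ?c = 0)"
    by (simp add: w_def vehicle_limited_speed_def add_diff_eq)
  have a: "?a > 0"
    using assms by (intro add_pos_pos divide_pos_pos)
  have b: "?b \<ge> 0"
    using assms by simp
  \<comment> \<open>The drag of the wind on a hovering vehicle stays below \<open>f_planar\<close>,
    so the polynomial is negative at speed 0.\<close>
  have "v_air\<^sup>2 < f_planar / K_d"
    using assms(4,5) by (metis not_less real_le_lsqrt real_less_rsqrt real_le_rsqrt)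
  then have c: "?c < 0"
    using \<open>K_d > 0\<close> by (simp add: field_simps)
  have root: "w > 0" "?a * w\<^sup>2 + ?b * w + ?c = 0"
    unfolding w_eq by (rule quadratic_Least_pos_root[OF a b c])+
  then show "vehicle_limited_speed m K_d r_min v_air f_planar > 0"
    by (simp add: w_def)
  fix v assume v: "0 \<le> v" "v \<le> vehicle_limited_speed m K_d r_min v_air f_planar"
  note root(2)
  moreover have "?a * v\<^sup>2 + ?b * v + ?c \<le> ?a * w\<^sup>2 + ?b * w + ?c"
    using strict_mono_quadratic[OF a b v(1), of w ?c] v(2)
    by (cases "v = w") (auto simp: w_def)
  moreover have "?a * v\<^sup>2 + ?b * v + ?c
      = m * (v\<^sup>2 / r_min) + K_d * (v + v_air)\<^sup>2 - f_planar"
    by (simp add: algebra_simps power2_eq_square)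
  ultimately show "m * (v\<^sup>2 / r_min) + K_d * (v + v_air)\<^sup>2 \<le> f_planar"
    by linarith
qed

text \<open>Derivatives are one-sided at the endpoints. As \<open>a < b\<close>, every point of the
  interval is a limit point of it, so the derivative within it is unique.\<close>

lemma vector_derivative_zero_within_Icc:
  fixes f :: "real \<Rightarrow> 'a::real_normed_vector"
  assumes "(f has_vector_derivative f') (at t within {a..b})" "t \<in> {a..b}" "a < b"
    and "\<And>s. s \<in> {a..b} \<Longrightarrow> f s = k"
  shows "f' = 0"
proof -
  have "((\<lambda>_. k) has_vector_derivative f') (at t within {a..b})"
    using assms(2,4) by (intro has_vector_derivative_transform[OF _ _ assms(1)]) auto
  then show ?thesis
    using vector_derivative_unique_within[OF _ _ has_vector_derivative_const, of t "{a..b}" k f']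
      assms(2,3) trivial_limit_within islimpt_Icc
    by (metis atLeastAtMost_iff)
qed

text \<open>In the plane the vectors orthogonal to \<open>v\<close> form a line, so \<open>u\<close>
  and \<open>w\<close> are parallel and Cauchy-Schwarz holds with equality.\<close>

lemma inner_squared_orthogonal_R2:
  fixes u v w :: "real^2"
  assumes "v \<noteq> 0" "u \<bullet> v = 0" "w \<bullet> v = 0"
  shows "(u \<bullet> w)\<^sup>2 = (norm u)\<^sup>2 * (norm w)\<^sup>2"
proof -
  have u: "u$1 * v$1 + u$2 * v$2 = 0" and w: "w$1 * v$1 + w$2 * v$2 = 0"
    using assms(2,3) by (simp_all add: inner_vec_def sum_2)
  \<comment> \<open>The factor is the determinant of \<open>u\<close> and \<open>w\<close>; some
    coordinate of \<open>v\<close> is nonzero, so it vanishes.\<close>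
  have "(u$1 * w$2 - u$2 * w$1) * v$1 = 0" "(u$1 * w$2 - u$2 * w$1) * v$2 = 0"
    using u w by algebra+
  then have "u$1 * w$2 - u$2 * w$1 = 0"
    using \<open>v \<noteq> 0\<close> by (auto simp: vec_eq_iff forall_2)
  \<comment> \<open>Lagrange's identity: \<open>(u \<bullet> w)\<^sup>2\<close> plus the squared
    determinant is the product of the squared norms.\<close>
  then show ?thesis
    unfolding dot_square_norm[symmetric] by (simp add: inner_vec_def sum_2) algebra
qed

text \<open>With \<open>u = p - c\<close>, differentiating the constants
  \<open>u \<bullet> u\<close>, \<open>p' \<bullet> p'\<close> and \<open>u \<bullet> p'\<close>
  shows that \<open>u\<close> and \<open>p''\<close> are both orthogonal to \<open>p'\<close>, hence
  parallel, and that their inner product is \<open>- s\<^sup>2\<close>.\<close>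

lemma planar_turn_acceleration:
  assumes "planar_turn r s {a..b} p p' p''" "a < b" "t \<in> {a..b}" "r > 0" "s \<noteq> 0"
  shows "norm (p'' t) = s\<^sup>2 / r"
proof -
  obtain c where c: "\<And>x. x \<in> {a..b} \<Longrightarrow> p x \<in> sphere c r"
    using assms(1) unfolding planar_turn_def by blast
  have p: "(p has_vector_derivative p' x) (at x within {a..b})"
    and p': "(p' has_vector_derivative p'' x) (at x within {a..b})"
    and s: "norm (p' x) = s" if "x \<in> {a..b}" for x
    using assms(1) that by (auto simp: planar_turn_def)
  define u where "u x = p x - c" for x
  have u: "(u has_vector_derivative p' x) (at x within {a..b})" if "x \<in> {a..b}" for x
    unfolding u_def using p[OF that] by (auto intro!: derivative_eq_intros)
  note inner_deriv = bounded_bilinear.has_vector_derivative[OF bounded_bilinear_inner]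
  have norm_u: "norm (u x) = r" if "x \<in> {a..b}" for x
    using c[OF that] by (simp add: u_def dist_norm norm_minus_commute)
  have u_p': "u x \<bullet> p' x = 0" if "x \<in> {a..b}" for x
    using vector_derivative_zero_within_Icc[OF inner_deriv[OF u u] that \<open>a < b\<close>, of "r\<^sup>2"]
      norm_u that by (simp add: dot_square_norm inner_commute)
  have p'_p'': "p'' t \<bullet> p' t = 0"
    using vector_derivative_zero_within_Icc[OF inner_deriv[OF p' p'] assms(3) \<open>a < b\<close>, of "s\<^sup>2"]
      s assms(3) by (simp add: dot_square_norm inner_commute)
  have "u t \<bullet> p'' t + p' t \<bullet> p' t = 0"
    using vector_derivative_zero_within_Icc[OF inner_deriv[OF u p'] assms(3) \<open>a < b\<close>, of 0]
      u_p' assms(3) by simp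
  then have u_p'': "u t \<bullet> p'' t = - s\<^sup>2"
    using s[OF assms(3)] by (simp add: dot_square_norm)
  have "p' t \<noteq> 0"
    using s[OF assms(3)] \<open>s \<noteq> 0\<close> by auto
  then have "(s\<^sup>2)\<^sup>2 = (r * norm (p'' t))\<^sup>2"
    using inner_squared_orthogonal_R2[OF _ u_p'[OF assms(3)] p'_p''] u_p'' norm_u[OF assms(3)]
    by (simp add: power_mult_distrib)
  then have "s\<^sup>2 = r * norm (p'' t)"
    using \<open>r > 0\<close> by (subst (asm) power2_eq_iff_nonneg) auto
  then show ?thesis
    using \<open>r > 0\<close> by (simp add: field_simps)
qed

lemma norm_drag_force:
  assumes "K_d \<ge> 0"
  shows "norm (drag_force K_d v) = K_d * (norm v)\<^sup>2"
  using assms by (simp add: drag_force_def norm_sgn)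

text \<open>Two triangle inequalities cover all wind directions: one bounds the relative speed by
  the head wind case, the other adds the drag to the inertial force as if they were aligned.\<close>

lemma norm_required_thrust_le:
  assumes "m \<ge> 0" "K_d \<ge> 0" "norm wind \<le> v_air"
    and "m * norm acc + K_d * (norm vel + v_air)\<^sup>2 \<le> f_planar"
  shows "norm (required_thrust m g K_d wind vel acc) \<le> sqrt (f_planar\<^sup>2 + (m * g)\<^sup>2)"
proof -
  have "norm (vel - wind) \<le> norm vel + v_air"
    using norm_triangle_ineq4[of vel wind] assms(3) by linarith
  then have "K_d * (norm (vel - wind))\<^sup>2 \<le> K_d * (norm vel + v_air)\<^sup>2"
    using \<open>K_d \<ge> 0\<close> by (intro mult_left_mono power_mono) auto
  then have "norm (m *\<^sub>R acc - drag_force K_d (vel - wind)) \<le> f_planar"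
    using norm_triangle_ineq4[of "m *\<^sub>R acc" "drag_force K_d (vel - wind)"] assms
    by (simp add: norm_drag_force)
  then show ?thesis
    by (simp add: required_thrust_def norm_Pair power_mono)
qed

theorem theorem2:
  fixes m g f_max K_d r_s \<Delta>T_s r_c r_min v_omax v_air :: real
    and f_planar v_cv v_cs \<tau>f v_c r_t t0 t1 :: real
    and p p' p'' wind :: "real \<Rightarrow> real^2"
  assumes "m > 0" and "f_max > m * g" and "K_d > 0" and "r_min > 0"
    and "f_planar = planar_force_limit m g f_max"
    and "0 \<le> v_air" and "v_air < sqrt (f_planar / K_d)"
    and "v_cv = vehicle_limited_speed m K_d r_min v_air f_planar"
    and "sensor_limited_speed m K_d v_air f_planar r_s r_c \<Delta>T_s v_omax v_cs \<tau>f"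
    and "v_c = min v_cv v_cs"
    and "r_t \<ge> r_min"
    and "t0 < t1" and "planar_turn r_t v_c {t0..t1} p p' p''"
    and "\<And>t. t \<in> {t0..t1} \<Longrightarrow> norm (wind t) \<le> v_air"
  shows "\<forall>t\<in>{t0..t1}. norm (required_thrust m g K_d (wind t) (p' t) (p'' t)) \<le> f_max"
proof
  fix t assume t: "t \<in> {t0..t1}"
  \<comment> \<open>This uses that \<open>sqrt\<close> of a negative number is negative; it yields \<open>(m * g)\<^sup>2 < f_max\<^sup>2\<close>.\<close>
  have "f_planar / K_d > 0"
    using assms(6,7) by (metis le_less_trans real_sqrt_gt_0_iff)
  then have "f_planar > 0"
    using \<open>K_d > 0\<close> by (simp add: zero_less_divide_iff)
  then have sq: "(m * g)\<^sup>2 < f_max\<^sup>2"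
    using assms(5) by (simp add: planar_force_limit_def)
  \<comment> \<open>The sign of \<open>g\<close> is left open, so \<open>m * g < f_max < 0\<close>
    has to be excluded; there \<open>m * g\<close> would have the larger square.\<close>
  have "f_max \<ge> 0"
  proof (rule ccontr)
    assume "\<not> f_max \<ge> 0"
    then have "f_max\<^sup>2 \<le> (m * g)\<^sup>2"
      using assms(2) by (simp add: abs_le_square_iff[symmetric])
    with sq show False by simp
  qed
  then have f_max: "sqrt (f_planar\<^sup>2 + (m * g)\<^sup>2) = f_max"
    using sq assms(5) by (simp add: planar_force_limit_def)
  have "v_cs > 0"
    using assms(9) by (simp add: sensor_limited_speed_def Let_def)
  have speed: "norm (p' t) = v_c"
    using assms(13) t by (simp add: planar_turn_def)
  have "v_cv > 0"
    using assms by (simp add: vehicle_limited_speed_pos)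
  \<comment> \<open>A nonzero speed gives the turn a tangent direction, on which the formula for the
    acceleration rests.\<close>
  then have "v_c > 0"
    using \<open>v_cs > 0\<close> assms(10) by simp
  then have "norm (p'' t) = v_c\<^sup>2 / r_t"
    using planar_turn_acceleration[OF assms(13,12) t] assms(4,11) by simp
  \<comment> \<open>The tightest admissible turn is the worst case.\<close>
  also have "\<dots> \<le> v_c\<^sup>2 / r_min"
    using assms(4,11) by (intro divide_left_mono) auto
  finally have "m * norm (p'' t) \<le> m * (v_c\<^sup>2 / r_min)"
    using \<open>m > 0\<close> by (intro mult_left_mono) auto
  moreover have "m * (v_c\<^sup>2 / r_min) + K_d * (v_c + v_air)\<^sup>2 \<le> f_planar"
    using assms \<open>v_c > 0\<close> by (intro vehicle_limited_speed_planar_force) auto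
  ultimately have "m * norm (p'' t) + K_d * (norm (p' t) + v_air)\<^sup>2 \<le> f_planar"
    using speed by simp
  then show "norm (required_thrust m g K_d (wind t) (p' t) (p'' t)) \<le> f_max"
    using norm_required_thrust_le[of m K_d "wind t" v_air] assms(1,3,14) t f_max by fastforce
qed

end
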